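(* Let $R=\mathbb F_{q_1}\times\cdots\times\mathbb F_{q_t}$ be a product of $t\ge1$ finite fields. If $t\le 2$, then $\mathcal D(R)$ has no edges.
   Context: $Z(R)$ is the set of zero-divisors of $R$ and $Z(R)^*=Z(R)\setminus\{0\}$. $\Gamma(R)$ is the simple graph with vertex set $Z(R)^*$, with distinct $x,y$ adjacent iff $xy=0$. $W\Gamma(R)$ is the simple graph with vertex set $Z(R)^*$, with distinct $x,y$ adjacent iff there exist nonzero $r\in\operatorname{Ann}(x)$ and nonzero $s\in\operatorname{Ann}(y)$ with $rs=0$. The weak zero-divisor difference graph $\mathcal D(R)$ is the graph on $Z(R)^*$ with edge set $E(W\Gamma(R))\setminus E(\Gamma(R))$, with resulting isolated vertices deleted. *)

theory Defs
  imports "HOL-Algebra.Chinese_Remainder" "Graph_Theory.Pair_Digraph"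
begin

text \<open>
  All rings are commutative, so left and right zero-divisors (annihilators) are not distinguished.
  Zero counts as a zero-divisor of every nonzero ring.
\<close>

definition zero_divisors :: "('a, 'm) ring_scheme \<Rightarrow> 'a set" where
  "zero_divisors R = {x \<in> carrier R. \<exists>y \<in> carrier R - {\<zero>\<^bsub>R\<^esub>}. x \<otimes>\<^bsub>R\<^esub> y = \<zero>\<^bsub>R\<^esub>}"

definition nonzero_zero_divisors :: "('a, 'm) ring_scheme \<Rightarrow> 'a set" where
  "nonzero_zero_divisors R = zero_divisors R - {\<zero>\<^bsub>R\<^esub>}"

definition Ann :: "('a, 'm) ring_scheme \<Rightarrow> 'a \<Rightarrow> 'a set" where
  "Ann R x = {r \<in> carrier R. r \<otimes>\<^bsub>R\<^esub> x = \<zero>\<^bsub>R\<^esub>}"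

text \<open>
  As usual in \<^theory>\<open>Graph_Theory.Pair_Digraph\<close>, a simple graph is a loop-free symmetric
  digraph: an edge between \<open>x\<close> and \<open>y\<close> is represented by the two arcs \<open>(x, y)\<close> and \<open>(y, x)\<close>.
\<close>

definition zero_divisor_graph :: "('a, 'm) ring_scheme \<Rightarrow> 'a pair_pre_digraph" where
  "zero_divisor_graph R =
    \<lparr> pverts = nonzero_zero_divisors R,
      parcs = {(x, y). x \<in> nonzero_zero_divisors R \<and> y \<in> nonzero_zero_divisors R \<and>
                 x \<noteq> y \<and> x \<otimes>\<^bsub>R\<^esub> y = \<zero>\<^bsub>R\<^esub>} \<rparr>"

definition weak_zero_divisor_graph :: "('a, 'm) ring_scheme \<Rightarrow> 'a pair_pre_digraph" where
  "weak_zero_divisor_graph R =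
    \<lparr> pverts = nonzero_zero_divisors R,
      parcs = {(x, y). x \<in> nonzero_zero_divisors R \<and> y \<in> nonzero_zero_divisors R \<and>
                 x \<noteq> y \<and>
                 (\<exists>r \<in> Ann R x - {\<zero>\<^bsub>R\<^esub>}. \<exists>s \<in> Ann R y - {\<zero>\<^bsub>R\<^esub>}. r \<otimes>\<^bsub>R\<^esub> s = \<zero>\<^bsub>R\<^esub>)} \<rparr>"

definition delete_isolated :: "'a pair_pre_digraph \<Rightarrow> 'a pair_pre_digraph" where
  "delete_isolated G =
    \<lparr> pverts = {v \<in> pverts G. \<exists>w. (v, w) \<in> parcs G \<or> (w, v) \<in> parcs G}, parcs = parcs G \<rparr>"

definition weak_zero_divisor_difference_graph ::
    "('a, 'm) ring_scheme \<Rightarrow> 'a pair_pre_digraph" where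
  "weak_zero_divisor_difference_graph R =
    delete_isolated
      \<lparr> pverts = nonzero_zero_divisors R,
        parcs = parcs (weak_zero_divisor_graph R) - parcs (zero_divisor_graph R) \<rparr>"

context cring
begin

lemma zero_divisor_graph_bidirected: "pair_bidirected_digraph (zero_divisor_graph R)"
proof unfold_locales
  show "symmetric (with_proj (zero_divisor_graph R))"
    by (auto simp: symmetric_def zero_divisor_graph_def nonzero_zero_divisors_def
        zero_divisors_def m_comm intro!: symI)
qed (auto simp: zero_divisor_graph_def)

lemma weak_zero_divisor_graph_bidirected: "pair_bidirected_digraph (weak_zero_divisor_graph R)"
proof unfold_locales
  have "\<exists>s \<in> Ann R y - {\<zero>}. \<exists>r \<in> Ann R x - {\<zero>}. s \<otimes> r = \<zero>"
    if "r \<in> Ann R x - {\<zero>}" "s \<in> Ann R y - {\<zero>}" "r \<otimes> s = \<zero>" for x y r s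
    using that m_comm[of r s] by (auto simp: Ann_def)
  then show "symmetric (with_proj (weak_zero_divisor_graph R))"
    by (auto simp: symmetric_def weak_zero_divisor_graph_def intro!: symI)
qed (auto simp: weak_zero_divisor_graph_def)

lemma weak_zero_divisor_difference_graph_bidirected:
  "pair_bidirected_digraph (weak_zero_divisor_difference_graph R)"
proof -
  interpret Z: pair_bidirected_digraph "zero_divisor_graph R"
    by (rule zero_divisor_graph_bidirected)
  interpret W: pair_bidirected_digraph "weak_zero_divisor_graph R"
    by (rule weak_zero_divisor_graph_bidirected)
  show ?thesis
  proof unfold_locales
    show "symmetric (with_proj (weak_zero_divisor_difference_graph R))"
      using Z.pair_sym_arcs W.pair_sym_arcs
      by (auto simp: symmetric_def weak_zero_divisor_difference_graph_def delete_isolated_def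
          sym_def)
  next
    fix e
    assume "e \<in> parcs (weak_zero_divisor_difference_graph R)"
    moreover from this have "e \<in> parcs (weak_zero_divisor_graph R)"
      by (auto simp: weak_zero_divisor_difference_graph_def delete_isolated_def)
    then have "fst e \<in> nonzero_zero_divisors R" "snd e \<in> nonzero_zero_divisors R"
      and ne: "fst e \<noteq> snd e"
      by (auto simp: weak_zero_divisor_graph_def)
    ultimately show "fst e \<in> pverts (weak_zero_divisor_difference_graph R)"
      and "snd e \<in> pverts (weak_zero_divisor_difference_graph R)"
      by (cases e; force simp: weak_zero_divisor_difference_graph_def delete_isolated_def)+
    show "fst e \<noteq> snd e" by (fact ne)
  qed
qed

end

end

theory Submission
  imports Defs
begin

text \<open>
  If \<open>x y \<noteq> 0\<close>, some coordinate \<open>i\<close> has \<open>x\<^sub>i \<noteq> 0\<close> and \<open>y\<^sub>i \<noteq> 0\<close>, so every \<open>r \<in> Ann(x)\<close> and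
  \<open>s \<in> Ann(y)\<close> vanish at \<open>i\<close>. If they are nonzero, then, as there is at most one other coordinate,
  both are nonzero there, and hence \<open>r s \<noteq> 0\<close>.
\<close>

text \<open>Consing is a ring homomorphism from \<open>RDirProd R (RDirProd_list Rs)\<close> to
  \<open>RDirProd_list (R # Rs)\<close>, so induction on the list peels off one coordinate of the
  product at a time.\<close>

lemma RDirProd_list_mult_nth:
  assumes "as \<in> carrier (RDirProd_list Rs)" "bs \<in> carrier (RDirProd_list Rs)" "i < length Rs"
  shows "(as \<otimes>\<^bsub>RDirProd_list Rs\<^esub> bs) ! i = as ! i \<otimes>\<^bsub>Rs ! i\<^esub> bs ! i"
  using assms
proof (induction Rs arbitrary: as bs i)
  case Nil
  then show ?case by simp
next
  case (Cons R Rs)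
  obtain a as' b bs' where eq: "as = a # as'" "bs = b # bs'"
    and car: "a \<in> carrier R" "b \<in> carrier R"
      "as' \<in> carrier (RDirProd_list Rs)" "bs' \<in> carrier (RDirProd_list Rs)"
    using Cons.prems(1,2) by (auto simp: RDirProd_list_carrier)
  have "as \<otimes>\<^bsub>RDirProd_list (R # Rs)\<^esub> bs = (a \<otimes>\<^bsub>R\<^esub> b) # (as' \<otimes>\<^bsub>RDirProd_list Rs\<^esub> bs')"
    using ring_hom_mult[OF RDirProd_list_hom1[of R Rs], of "(a, as')" "(b, bs')"] car
    by (simp add: eq RDirProd_carrier) (simp add: RDirProd_def DirProd_def monoid.defs)
  then show ?case
    using Cons.IH[OF car(3,4)] Cons.prems(3) by (cases i) (auto simp: eq)
qed

lemma RDirProd_list_zero_eq_map: "\<zero>\<^bsub>RDirProd_list Rs\<^esub> = map zero Rs"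
  unfolding RDirProd_list_zero by (induction Rs) simp_all

lemma RDirProd_list_eq_zero_iff:
  assumes "as \<in> carrier (RDirProd_list Rs)"
  shows "as = \<zero>\<^bsub>RDirProd_list Rs\<^esub> \<longleftrightarrow> (\<forall>i < length Rs. as ! i = \<zero>\<^bsub>Rs ! i\<^esub>)"
  using RDirProd_list_carrier_mem(1)[OF assms]
  by (auto simp: RDirProd_list_zero_eq_map list_eq_iff_nth_eq)

text \<open>Since no factor has proper zero-divisors, vanishing of a product depends only on the
  supports of the two lists: they must be disjoint. The fields of the theorem enter only through
  this.\<close>

lemma RDirProd_list_mult_eq_zero_iff:
  assumes "\<And>i. i < length Rs \<Longrightarrow> domain (Rs ! i)"
    and "as \<in> carrier (RDirProd_list Rs)" "bs \<in> carrier (RDirProd_list Rs)"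
  shows "as \<otimes>\<^bsub>RDirProd_list Rs\<^esub> bs = \<zero>\<^bsub>RDirProd_list Rs\<^esub> \<longleftrightarrow>
    (\<forall>i < length Rs. as ! i = \<zero>\<^bsub>Rs ! i\<^esub> \<or> bs ! i = \<zero>\<^bsub>Rs ! i\<^esub>)"
proof -
  have "ring (RDirProd_list Rs)"
    using assms(1) by (intro RDirProd_list_is_ring) (simp add: domain.axioms(1) cring.axioms(1))
  then interpret P: ring "RDirProd_list Rs" .
  have "(as \<otimes>\<^bsub>RDirProd_list Rs\<^esub> bs) ! i = \<zero>\<^bsub>Rs ! i\<^esub> \<longleftrightarrow>
      as ! i = \<zero>\<^bsub>Rs ! i\<^esub> \<or> bs ! i = \<zero>\<^bsub>Rs ! i\<^esub>" if "i < length Rs" for i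
    using domain.integral_iff[OF assms(1)[OF that]] that RDirProd_list_carrier_mem(2)[OF _ that] assms(2,3)
    by (simp add: RDirProd_list_mult_nth)
  then show ?thesis
    using assms(2,3) by (simp add: RDirProd_list_eq_zero_iff)
qed

text \<open>The elements \<open>r\<close> and \<open>s\<close> are the witnesses of an arc of the
  weak graph, so every such arc is already an arc of the zero-divisor graph.\<close>

lemma RDirProd_list_mult_eq_zero_if_Ann:
  fixes Rs :: "('a, 'm) ring_scheme list"
  defines "P \<equiv> RDirProd_list Rs"
  assumes domains: "\<And>i. i < length Rs \<Longrightarrow> domain (Rs ! i)"
    and "length Rs \<le> 2"
    and x: "x \<in> carrier P" and y: "y \<in> carrier P"
    and r: "r \<in> Ann P x - {\<zero>\<^bsub>P\<^esub>}" and s: "s \<in> Ann P y - {\<zero>\<^bsub>P\<^esub>}"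
    and rs: "r \<otimes>\<^bsub>P\<^esub> s = \<zero>\<^bsub>P\<^esub>"
  shows "x \<otimes>\<^bsub>P\<^esub> y = \<zero>\<^bsub>P\<^esub>"
proof (rule ccontr)
  note mult_zero = RDirProd_list_mult_eq_zero_iff[OF domains, folded P_def]
  note eq_zero = RDirProd_list_eq_zero_iff[of _ Rs, folded P_def]
  have car: "r \<in> carrier P" "s \<in> carrier P" using r s by (auto simp: Ann_def)
  assume "x \<otimes>\<^bsub>P\<^esub> y \<noteq> \<zero>\<^bsub>P\<^esub>"
  then obtain i where i: "i < length Rs" "x ! i \<noteq> \<zero>\<^bsub>Rs ! i\<^esub>" "y ! i \<noteq> \<zero>\<^bsub>Rs ! i\<^esub>"
    using mult_zero[OF _ x y] by auto
  have ri: "r ! i = \<zero>\<^bsub>Rs ! i\<^esub>" using r i mult_zero[OF _ car(1) x] by (auto simp: Ann_def)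
  have si: "s ! i = \<zero>\<^bsub>Rs ! i\<^esub>" using s i mult_zero[OF _ car(2) y] by (auto simp: Ann_def)
  obtain j where j: "j < length Rs" "r ! j \<noteq> \<zero>\<^bsub>Rs ! j\<^esub>" using r eq_zero[OF car(1)] by auto
  obtain k where k: "k < length Rs" "s ! k \<noteq> \<zero>\<^bsub>Rs ! k\<^esub>" using s eq_zero[OF car(2)] by auto
  have "j \<noteq> i" "k \<noteq> i" using ri si j k by auto
  \<comment> \<open>The indices are at most 0 and 1, and only one of them can differ from
    \<open>i\<close>.\<close>
  then have "j = k" using i(1) j(1) k(1) \<open>length Rs \<le> 2\<close> by linarith
  then show False using rs mult_zero[OF _ car] j k by auto
qed

theorem theorem4p1:
  fixes Fs :: "('a, 'm) ring_scheme list" and t :: nat and R :: "'a list ring"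
  assumes "t \<ge> 1"
    and "length Fs = t"
    and "\<And>i. i < t \<Longrightarrow> field (Fs ! i)"
    and "\<And>i. i < t \<Longrightarrow> finite (carrier (Fs ! i))"
    and "R = RDirProd_list Fs"
    and "t \<le> 2"
  shows "parcs (weak_zero_divisor_difference_graph R) = {}"
proof -
  have "domain (Fs ! i)" if "i < length Fs" for i
    using assms(2,3) that by (simp add: field.axioms(1))
  then have "x \<otimes>\<^bsub>R\<^esub> y = \<zero>\<^bsub>R\<^esub>"
    if "(x, y) \<in> parcs (weak_zero_divisor_graph R)" for x y
    using RDirProd_list_mult_eq_zero_if_Ann[of Fs x y] that assms(2,5,6)
    by (auto simp: weak_zero_divisor_graph_def nonzero_zero_divisors_def zero_divisors_def)
  \<comment> \<open>Deleting isolated vertices keeps all arcs, and the two graphs share the vertex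
    and distinctness conditions on arcs. Hence a zero product is all that is needed to make the
    difference empty.\<close>
  then show ?thesis
    by (auto simp: weak_zero_divisor_difference_graph_def delete_isolated_def
        weak_zero_divisor_graph_def zero_divisor_graph_def)
qed

end
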